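(* Let $\epsilon>0$ and $\eta>0$ be given. Let $\{\mathbf x^k\}\subseteq\mathcal F$ be a sequence of feasible points such that $I^{\epsilon}_{up}(\mathbf x^k)\ne\emptyset$ and $I^{\epsilon}_{low}(\mathbf x^k)\ne\emptyset$ for all $k$, and $$\lim_{k\to\infty}S^{\epsilon}_{\mathrm{MVP}}(\mathbf x^k)=0.$$ Then there exists $\bar k>0$ such that, for all $k\ge\bar k$, $$m^{\epsilon}(\mathbf x^k)\le M^{\epsilon}(\mathbf x^k)+\eta.$$
   Context: $n\ge 1$, $C>0$, $\mathbf y\in\{-1,1\}^n$, $Q$ is a symmetric positive semidefinite $n\times n$ real matrix, $\mathbf e\in\mathbb R^n$ is the all-ones vector, $f(\mathbf x)=\frac12\mathbf x^TQ\mathbf x-\mathbf e^T\mathbf x$, and the feasible set is $\mathcal F=\{\mathbf x\in\mathbb R^n:\ \mathbf y^T\mathbf x=0,\ \mathbf 0\le\mathbf x\le C\mathbf e\}$. $\|\cdot\|$ is the Euclidean norm. For $\epsilon>0$ and $\mathbf x\in\mathcal F$ let $I^{\epsilon}_{up}(\mathbf x)=\{r: x_r\le C-\epsilon,\ y_r=1,\text{ or } x_r\ge\epsilon,\ y_r=-1\}$, $I^{\epsilon}_{low}(\mathbf x)=\{r: x_r\le C-\epsilon,\ y_r=-1,\text{ or } x_r\ge\epsilon,\ y_r=1\}$, and $$m^{\epsilon}(\mathbf x)=\max_{r\in I^{\epsilon}_{up}(\mathbf x)}-\frac{\nabla f(\mathbf x)_r}{y_r},\qquad M^{\epsilon}(\mathbf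 x)=\min_{r\in I^{\epsilon}_{low}(\mathbf x)}-\frac{\nabla f(\mathbf x)_r}{y_r}.$$ When both sets are nonempty, let $i\in I^\epsilon_{up}(\mathbf x)$ attain the max and $j\in I^\epsilon_{low}(\mathbf x)$ attain the min (the pair is treated as unique; if there are several, one is fixed for each $\mathbf x$). Let $\mathbf d\in\mathbb R^n$ have components $1/y_i$ at $i$, $-1/y_j$ at $j$, and $0$ elsewhere; let $\bar\beta=\min\{\beta_i,\beta_j\}$ where $\beta_h=x_h$ if $d_h<0$ and $\beta_h=C-x_h$ if $d_h>0$. Let $\alpha\ge0$ be the exact minimizing stepsize of $f(\mathbf x+\alpha\mathbf d)$ over $\alpha\in[0,\bar\beta]$, i.e. $\alpha=\max\{0,\min\{-\nabla f(\mathbf x)^T\mathbf d/(\mathbf d^TQ\mathbf d),\bar\beta\}\}$ if $\mathbf d^TQ\mathbf d>0$; if $\mathbf d^TQ\mathbf d=0$, $\alpha=\bar\beta$ when $\nabla f(\mathbf x)^T\mathbf d<0$ and $\alpha=0$ otherwise. The MVP $\epsilon$-step is $S^{\epsilon}_{\mathrm{MVP}}(\mathbf x)=\|\alpha\mathbf d\|=\sqrt2\,|\alpha|$ (with $S^{\epsilon}_{\mathrm{MVP}}(\mathbf x)=0$ if $i=j$). *)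

theory Defs
  imports "HOL-Analysis.Analysis"
begin

text \<open>
  The dual SVM problem: minimize \<open>1/2 x\<^sup>T Q x - e\<^sup>T x\<close> subject to
  \<open>y\<^sup>T x = 0\<close> and \<open>0 \<le> x \<le> C e\<close>. The dimension is the cardinality of the index type.
\<close>

definition psd :: "real^'n^'n \<Rightarrow> bool" where
  "psd Q \<longleftrightarrow> (\<forall>v. 0 \<le> v \<bullet> (Q *v v))"

definition objective :: "real^'n^'n \<Rightarrow> real^'n \<Rightarrow> real" where
  "objective Q x = 1/2 * (x \<bullet> (Q *v x)) - (\<chi> r. 1) \<bullet> x"

definition gradient :: "('a::real_inner \<Rightarrow> real) \<Rightarrow> 'a \<Rightarrow> 'a" where
  "gradient f x = (THE D. GDERIV f x :> D)"

definition feasible :: "real \<Rightarrow> real^'n \<Rightarrow> (real^'n) set" where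
  "feasible C y = {x. y \<bullet> x = 0 \<and> (\<forall>r. 0 \<le> x $ r \<and> x $ r \<le> C)}"

definition I_up :: "real \<Rightarrow> real^'n \<Rightarrow> real \<Rightarrow> real^'n \<Rightarrow> 'n set" where
  "I_up C y \<epsilon> x = {r. (x $ r \<le> C - \<epsilon> \<and> y $ r = 1) \<or> (x $ r \<ge> \<epsilon> \<and> y $ r = -1)}"

definition I_low :: "real \<Rightarrow> real^'n \<Rightarrow> real \<Rightarrow> real^'n \<Rightarrow> 'n set" where
  "I_low C y \<epsilon> x = {r. (x $ r \<le> C - \<epsilon> \<and> y $ r = -1) \<or> (x $ r \<ge> \<epsilon> \<and> y $ r = 1)}"

definition score :: "real^'n^'n \<Rightarrow> real^'n \<Rightarrow> real^'n \<Rightarrow> 'n \<Rightarrow> real" where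
  "score Q y x r = - (gradient (objective Q) x $ r / y $ r)"

definition m_up :: "real^'n^'n \<Rightarrow> real \<Rightarrow> real^'n \<Rightarrow> real \<Rightarrow> real^'n \<Rightarrow> real" where
  "m_up Q C y \<epsilon> x = Max (score Q y x ` I_up C y \<epsilon> x)"

definition M_low :: "real^'n^'n \<Rightarrow> real \<Rightarrow> real^'n \<Rightarrow> real \<Rightarrow> real^'n \<Rightarrow> real" where
  "M_low Q C y \<epsilon> x = Min (score Q y x ` I_low C y \<epsilon> x)"

text \<open>
  Ties in the choice of a most violating pair are broken by an arbitrary but fixed function
  \<open>sel\<close>; nothing is required of it where one of the index sets is empty.
\<close>

definition mvp_selection ::
    "real^'n^'n \<Rightarrow> real \<Rightarrow> real^'n \<Rightarrow> real \<Rightarrow> (real^'n \<Rightarrow> 'n \<times> 'n) \<Rightarrow> bool" where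
  "mvp_selection Q C y \<epsilon> sel \<longleftrightarrow>
     (\<forall>x\<in>feasible C y. I_up C y \<epsilon> x \<noteq> {} \<and> I_low C y \<epsilon> x \<noteq> {} \<longrightarrow>
        (case sel x of (i, j) \<Rightarrow>
           i \<in> I_up C y \<epsilon> x \<and> score Q y x i = m_up Q C y \<epsilon> x \<and>
           j \<in> I_low C y \<epsilon> x \<and> score Q y x j = M_low Q C y \<epsilon> x))"

text \<open>Only meaningful for \<open>i \<noteq> j\<close>.\<close>

definition pair_dir :: "real^'n \<Rightarrow> 'n \<Rightarrow> 'n \<Rightarrow> real^'n" where
  "pair_dir y i j = (\<chi> h. if h = i then 1 / y $ i else if h = j then - (1 / y $ j) else 0)"

text \<open>Only meaningful for \<open>d $ h \<noteq> 0\<close>.\<close>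

definition max_step_at :: "real \<Rightarrow> real^'n \<Rightarrow> real^'n \<Rightarrow> 'n \<Rightarrow> real" where
  "max_step_at C x d h = (if d $ h < 0 then x $ h else C - x $ h)"

definition max_step :: "real \<Rightarrow> real^'n \<Rightarrow> real^'n \<Rightarrow> 'n \<Rightarrow> 'n \<Rightarrow> real" where
  "max_step C x d i j = min (max_step_at C x d i) (max_step_at C x d j)"

text \<open>
  The closed form of a minimizer of \<open>\<alpha> \<mapsto> objective Q (x + \<alpha> d)\<close> on the interval from 0 to \<open>b\<close>.
  The objective is affine along \<open>d\<close> if \<open>d\<^sup>T Q d = 0\<close>; if it is even constant there,
  the step 0 is chosen.
\<close>

definition exact_step :: "real^'n^'n \<Rightarrow> real^'n \<Rightarrow> real^'n \<Rightarrow> real \<Rightarrow> real" where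
  "exact_step Q x d b =
     (let g = gradient (objective Q) x \<bullet> d; q = d \<bullet> (Q *v d)
      in if q > 0 then max 0 (min (- g / q) b)
         else if g < 0 then b else 0)"

definition S_MVP :: "real^'n^'n \<Rightarrow> real \<Rightarrow> real^'n \<Rightarrow> (real^'n \<Rightarrow> 'n \<times> 'n) \<Rightarrow> real^'n \<Rightarrow> real" where
  "S_MVP Q C y sel x =
     (case sel x of (i, j) \<Rightarrow>
        if i = j then 0
        else let d = pair_dir y i j
             in norm (exact_step Q x d (max_step C x d i j) *\<^sub>R d))"

end

theory Submission
  imports Defs
begin

text \<open>
  A pair violating the optimality condition by more than \<open>\<eta>\<close> has slope at most \<open>-\<eta>\<close> along its
  direction \<open>d\<close>, and the \<open>\<epsilon>\<close>-margin in the index sets leaves room for a step of length \<open>\<epsilon>\<close>.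
  There are finitely many directions, so their curvatures \<open>d\<^sup>T Q d\<close> are bounded by some \<open>K\<close>, and
  the exact step is at least \<open>min (\<eta> / K) \<epsilon>\<close>. This contradicts steps tending to 0.
\<close>

lemma inner_pair_dir:
  assumes "i \<noteq> j"
  shows "g \<bullet> pair_dir y i j = g $ i / y $ i - g $ j / y $ j"
proof -
  have "g \<bullet> pair_dir y i j
      = (\<Sum>h\<in>UNIV. (if h = i then g $ h / y $ i else 0) - (if h = j then g $ h / y $ j else 0))"
    using assms by (auto simp: inner_vec_def pair_dir_def intro!: sum.cong)
  then show ?thesis
    by (simp add: sum_subtractf)
qed

text \<open>The entry at \<open>i\<close> grows exactly when \<open>y $ i = 1\<close>, where
  \<open>I_up\<close> keeps \<open>x $ i\<close> at least \<open>\<epsilon>\<close> below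
  \<open>C\<close>; otherwise it shrinks and \<open>I_up\<close> keeps it at least
  \<open>\<epsilon>\<close>. At \<open>j\<close> both signs flip.\<close>

lemma max_step_pair_dir_ge:
  assumes "i \<noteq> j" and "i \<in> I_up C y \<epsilon> x" and "j \<in> I_low C y \<epsilon> x"
  shows "\<epsilon> \<le> max_step C x (pair_dir y i j) i j"
  using assms by (auto simp: max_step_def max_step_at_def pair_dir_def I_up_def I_low_def)

lemma norm_pair_dir_ge_1:
  assumes "y $ i \<in> {-1, 1}"
  shows "1 \<le> norm (pair_dir y i j)"
  using component_le_norm_cart[of "pair_dir y i j" i] assms
  by (auto simp: pair_dir_def)

text \<open>With positive curvature, the unconstrained minimizer is at least
  \<open>\<eta> / K\<close>, and clipping only lowers it to \<open>b\<close>. Otherwise the negative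
  slope makes the step \<open>b\<close> itself.\<close>

lemma exact_step_ge:
  assumes "gradient (objective Q) x \<bullet> d \<le> - \<eta>" and "\<eta> > 0"
    and "d \<bullet> (Q *v d) \<le> K" and "\<epsilon> \<le> b"
  shows "min (\<eta> / K) \<epsilon> \<le> exact_step Q x d b"
proof (cases "d \<bullet> (Q *v d) > 0")
  case True
  then have "\<eta> / K \<le> - (gradient (objective Q) x \<bullet> d) / (d \<bullet> (Q *v d))"
    using assms by (intro frac_le) auto
  with True assms(4) show ?thesis
    unfolding exact_step_def Let_def by (auto simp del: minus_divide_left)
next
  case False
  with assms show ?thesis
    by (auto simp: exact_step_def)
qed

lemma S_MVP_ge:
  assumes y: "\<And>r. y $ r \<in> {-1, 1}"
    and "\<eta> > 0"
    and K: "\<And>i j. pair_dir y i j \<bullet> (Q *v pair_dir y i j) \<le> K"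
    and sel: "mvp_selection Q C y \<epsilon> sel" "x \<in> feasible C y"
      "I_up C y \<epsilon> x \<noteq> {}" "I_low C y \<epsilon> x \<noteq> {}"
    and violating: "m_up Q C y \<epsilon> x > M_low Q C y \<epsilon> x + \<eta>"
  shows "min (\<eta> / K) \<epsilon> \<le> S_MVP Q C y sel x"
proof -
  obtain i j where ij: "sel x = (i, j)"
    by fastforce
  with sel have i: "i \<in> I_up C y \<epsilon> x" "score Q y x i = m_up Q C y \<epsilon> x"
    and j: "j \<in> I_low C y \<epsilon> x" "score Q y x j = M_low Q C y \<epsilon> x"
    unfolding mvp_selection_def by (auto dest!: bspec)
  \<comment> \<open>A common index would force equal scores, against a gap above
    \<open>\<eta> > 0\<close>.\<close>
  have "i \<noteq> j"
    using i j violating \<open>\<eta> > 0\<close> by auto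
  define d where "d = pair_dir y i j"
  \<comment> \<open>The slope is the score at \<open>j\<close> minus the score at \<open>i\<close>,
    that is \<open>M_low\<close> minus \<open>m_up\<close>.\<close>
  have "gradient (objective Q) x \<bullet> d \<le> - \<eta>"
    using i j violating unfolding d_def inner_pair_dir[OF \<open>i \<noteq> j\<close>] score_def by linarith
  then have step: "min (\<eta> / K) \<epsilon> \<le> exact_step Q x d (max_step C x d i j)"
    unfolding d_def
    by (rule exact_step_ge[OF _ \<open>\<eta> > 0\<close> K max_step_pair_dir_ge[OF \<open>i \<noteq> j\<close> i(1) j(1)]])
  have "min (\<eta> / K) \<epsilon> * 1 \<le> \<bar>exact_step Q x d (max_step C x d i j)\<bar> * norm d"
    using step norm_pair_dir_ge_1[OF y] unfolding d_def
    by (intro mult_mono) auto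
  then show ?thesis
    using ij \<open>i \<noteq> j\<close> by (simp add: S_MVP_def d_def Let_def)
qed

theorem theorem6:
  fixes Q :: "real^'n^'n" and C \<epsilon> \<eta> :: real and y :: "real^'n"
    and sel :: "real^'n \<Rightarrow> 'n \<times> 'n" and x :: "nat \<Rightarrow> real^'n"
  assumes "C > 0"
    and "\<And>r. y $ r \<in> {-1, 1}"
    and "transpose Q = Q"
    and "psd Q"
    and "\<epsilon> > 0"
    and "\<eta> > 0"
    and "mvp_selection Q C y \<epsilon> sel"
    and "\<And>k. x k \<in> feasible C y"
    and "\<And>k. I_up C y \<epsilon> (x k) \<noteq> {}"
    and "\<And>k. I_low C y \<epsilon> (x k) \<noteq> {}"
    and "(\<lambda>k. S_MVP Q C y sel (x k)) \<longlonglongrightarrow> 0"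
  shows "\<exists>kbar>0. \<forall>k\<ge>kbar. m_up Q C y \<epsilon> (x k) \<le> M_low Q C y \<epsilon> (x k) + \<eta>"
proof -
  define q where "q = (\<lambda>(i, j). pair_dir y i j \<bullet> (Q *v pair_dir y i j))"
  \<comment> \<open>The 1 keeps \<open>K\<close> positive even if every curvature vanishes, so that
    \<open>\<eta> / K\<close> is a positive threshold.\<close>
  define K where "K = max 1 (Max (range q))"
  have "K > 0"
    by (simp add: K_def)
  have "q (i, j) \<le> K" for i j
    unfolding K_def by (intro max.coboundedI2 Max_ge) auto
  then have K: "pair_dir y i j \<bullet> (Q *v pair_dir y i j) \<le> K" for i j
    unfolding q_def by simp
  have "min (\<eta> / K) \<epsilon> > 0"
    using assms(5,6) \<open>K > 0\<close> by simp
  then obtain N where N: "\<And>k. k \<ge> N \<Longrightarrow> S_MVP Q C y sel (x k) < min (\<eta> / K) \<epsilon>"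
    using order_tendstoD(2)[OF assms(11)] unfolding eventually_sequentially by blast
  \<comment> \<open>\<open>Suc N\<close> rather than \<open>N\<close>, since \<open>kbar\<close>
    must be positive.\<close>
  have "m_up Q C y \<epsilon> (x k) \<le> M_low Q C y \<epsilon> (x k) + \<eta>" if "k \<ge> Suc N" for k
  proof (rule ccontr)
    assume "\<not> ?thesis"
    then have "min (\<eta> / K) \<epsilon> \<le> S_MVP Q C y sel (x k)"
      using S_MVP_ge[OF assms(2,6) K assms(7-10)] by simp
    with N[of k] that show False
      by linarith
  qed
  then show ?thesis
    by blast
qed

end
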